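(* Let $P$ be a poset (possibly infinite) whose underlying set is the union of two chains, and suppose that its incomparability graph $\mathrm{Inc}(P)$ is connected. Then the following properties are equivalent: (i) $\mathrm{Inc}(P)$ contains, as an induced subgraph, a direct sum of finite paths of arbitrarily large length (i.e. a direct sum $\bigoplus_n Q_n$ of finite paths $Q_n$ whose lengths are unbounded); (ii) the detour of $\mathrm{Inc}(P)$ is infinite, i.e. $\mathrm{Inc}(P)$ has induced finite paths of arbitrarily large length; (iii) the diameter of $\mathrm{Inc}(P)$ is infinite; (iv) $\mathrm{Inc}(P)$ contains an infinite induced path.
   Context: Graphs are undirected, simple, loopless, possibly infinite. For a poset $P=(V,\le)$, the incomparability graph $\mathrm{Inc}(P)$ has vertex set $V$ and edges the pairs $\{u,v\}$ of incomparable elements. A chain is a totally ordered subset. A path is a graph whose vertices can be injectively mapped by $f$ onto an interval of $\mathbb N$ so that $\{u,v\}$ is an edge iff $|f(u)-f(v)|=1$; a finite path on $n$ vertices has length $n-1$; the (one way) infinite path has vertices indexed by $\mathbb N$. An induced path of $G$ is an induced subgraph of $G$ that is a path. The direct sum of a family of graphs with pairwise disjoint vertex sets is their disjoint union (no edges between distinct members). The distance $d_G(x,y)$ is the length of a shortest path from $x$ to $y$ ($\infty$ if none), and the diameter of $G$ is $\sup\{d_G(x,y):x,y\in V(G)\}$. The detour of $G$ is the supremum of the lengths of the finite induced paths of $G$. *)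

theory Defs
  imports "Graph_Theory.Graph_Theory" "HOL-Library.Extended_Nat" "HOL-Library.Disjoint_Sets"
begin

text \<open>Undirected simple graphs, possibly infinite, are symmetric loop-free digraphs
  (locale \<^locale>\<open>pair_bidirected_digraph\<close>): an edge between \<open>u\<close> and \<open>v\<close> is the pair of
  arcs \<open>(u, v)\<close>, \<open>(v, u)\<close>.\<close>

definition incomparability_graph :: "'a set \<Rightarrow> 'a rel \<Rightarrow> 'a pair_pre_digraph" where
  "incomparability_graph V r =
     \<lparr> pverts = V, parcs = {(u, v). u \<in> V \<and> v \<in> V \<and> (u, v) \<notin> r \<and> (v, u) \<notin> r} \<rparr>"

lemma pair_bidirected_digraph_incomparability_graph:
  assumes "partial_order_on V r"
  shows "pair_bidirected_digraph (incomparability_graph V r)"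
  using assms unfolding incomparability_graph_def
  by unfold_locales
    (auto simp: symmetric_def sym_def arcs_ends_conv partial_order_on_def preorder_on_def refl_on_def)

definition nat_interval :: "nat set \<Rightarrow> bool" where
  "nat_interval I \<longleftrightarrow> (\<forall>a\<in>I. \<forall>b\<in>I. {a..b} \<subseteq> I)"

definition path_graph :: "'a pair_pre_digraph \<Rightarrow> bool" where
  "path_graph Q \<longleftrightarrow> pair_bidirected_digraph Q \<and>
     (\<exists>f I. nat_interval I \<and> bij_betw f (pverts Q) I \<and>
        (\<forall>u\<in>pverts Q. \<forall>v\<in>pverts Q. (u, v) \<in> parcs Q \<longleftrightarrow> \<bar>int (f u) - int (f v)\<bar> = 1))"

text \<open>A finite path has at least one vertex, so that its length is a natural number
  and no truncated subtraction occurs in \<open>path_length\<close>.\<close>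

definition finite_path :: "'a pair_pre_digraph \<Rightarrow> bool" where
  "finite_path Q \<longleftrightarrow> path_graph Q \<and> finite (pverts Q) \<and> pverts Q \<noteq> {}"

definition path_length :: "'a pair_pre_digraph \<Rightarrow> nat" where
  "path_length Q = card (pverts Q) - 1"

text \<open>An infinite interval of the naturals is a final segment, so these are exactly the
  one way infinite paths.\<close>

definition infinite_path :: "'a pair_pre_digraph \<Rightarrow> bool" where
  "infinite_path Q \<longleftrightarrow> path_graph Q \<and> infinite (pverts Q)"

text \<open>Only meaningful if the vertex sets are pairwise disjoint, which has to be required
  separately.\<close>

definition direct_sum :: "('i \<Rightarrow> 'a pair_pre_digraph) \<Rightarrow> 'i set \<Rightarrow> 'a pair_pre_digraph" where
  "direct_sum Q I = \<lparr> pverts = (\<Union>i\<in>I. pverts (Q i)), parcs = (\<Union>i\<in>I. parcs (Q i)) \<rparr>"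

text \<open>The infimum is \<open>\<infinity>\<close> if there is no path.\<close>

definition graph_dist :: "'a pair_pre_digraph \<Rightarrow> 'a \<Rightarrow> 'a \<Rightarrow> enat" where
  "graph_dist G x y = Inf {enat (length p) | p. pre_digraph.apath (with_proj G) x p y}"

definition diameter :: "'a pair_pre_digraph \<Rightarrow> enat" where
  "diameter G = Sup {graph_dist G x y | x y. x \<in> pverts G \<and> y \<in> pverts G}"

definition detour :: "'a pair_pre_digraph \<Rightarrow> enat" where
  "detour G = Sup {enat (path_length Q) | Q.
     finite_path Q \<and> induced_subgraph (with_proj Q) (with_proj G)}"

end

theory Submission
  imports Defs
begin

text \<open>An induced path \<open>a 0, \<dots>, a n\<close> in the incomparability graph of a poset is monotone, in the
  sense that \<open>a i < a j\<close> whenever \<open>i + 2 \<le> j\<close> (or dually). In width two a walk climbs at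
  most three steps of such a path per edge, so long induced paths have distant ends.
  Conversely, the balls around a vertex \<open>c\<close> are convex towards \<open>c\<close>. If they do not exhaust
  the graph, then after dualising there are \<open>c \<le> y 0 \<le> y 1 \<le> \<dots>\<close> outside larger and larger
  balls; connecting each \<open>y k\<close> to \<open>y (k + 1)\<close> outside the \<open>k\<close>-th ball gives an infinite walk that
  leaves every ball, and an induced ray is extracted from it. Finally, deleting vertices cuts
  a ray into a direct sum of longer and longer finite paths.\<close>

section \<open>Walks and relation powers\<close>

text \<open>Loops pad a walk to any greater length, so powers of the reflexive closure express "at
  most \<open>m\<close> steps"; balls are later encoded this way.\<close>

lemma relpow_imp_reflcl_relpow:
  assumes "(x, y) \<in> R ^^ n" "n \<le> m"
  shows "(x, y) \<in> (R\<^sup>=) ^^ m"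
proof -
  have "(x, y) \<in> (R\<^sup>=) ^^ n"
    using assms(1) by (induction n arbitrary: y) auto
  moreover have "(y, y) \<in> (R\<^sup>=) ^^ k" for k
    by (induction k) auto
  ultimately have "(x, y) \<in> (R\<^sup>=) ^^ (n + (m - n))" by (rule relpow_trans)
  then show ?thesis
    using assms(2) by simp
qed

lemma reflcl_relpow_mono: "(x, y) \<in> (R\<^sup>=) ^^ n \<Longrightarrow> n \<le> m \<Longrightarrow> (x, y) \<in> (R\<^sup>=) ^^ m"
  using relpow_imp_reflcl_relpow[where R = "R\<^sup>="] by simp

lemma reflcl_relpow_imp_relpow: "(x, y) \<in> (R\<^sup>=) ^^ m \<Longrightarrow> \<exists>n\<le>m. (x, y) \<in> R ^^ n"
proof (induction m arbitrary: y)
  case (Suc m)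
  then obtain z where z: "(x, z) \<in> (R\<^sup>=) ^^ m" "(z, y) \<in> R\<^sup>=" by auto
  then obtain n where n: "n \<le> m" "(x, z) \<in> R ^^ n" using Suc.IH by blast
  show ?case
  proof (cases "z = y")
    case True
    with n show ?thesis by (auto intro: exI[of _ n])
  next
    case False
    with n z have "(x, y) \<in> R ^^ Suc n" by auto
    with n(1) show ?thesis by (intro exI[of _ "Suc n"]) simp
  qed
qed auto

lemma sym_relpow:
  assumes "sym R" "(x, y) \<in> R ^^ n"
  shows "(y, x) \<in> R ^^ n"
  using assms(2)
proof (induction n arbitrary: y)
  case (Suc n)
  then obtain z where "(x, z) \<in> R ^^ n" "(z, y) \<in> R" by auto
  then show ?case
    using Suc.IH assms(1) by (meson relpow_Suc_I2 symD)
qed simp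

lemma (in pair_wf_digraph) awalk_imp_relpow:
  "awalk u p v \<Longrightarrow> (u, v) \<in> parcs G ^^ length p"
proof (induction p arbitrary: u)
  case (Cons e p)
  then have "(u, snd e) \<in> parcs G" "(snd e, v) \<in> parcs G ^^ length p"
    by (auto simp: awalk_Cons_iff)
  then show ?case by (metis length_Cons relpow_Suc_I2)
qed (simp add: awalk_Nil_iff)

lemma (in pair_wf_digraph) relpow_imp_awalk:
  assumes "(u, v) \<in> parcs G ^^ n" "u \<in> pverts G"
  shows "\<exists>p. awalk u p v \<and> length p = n"
  using assms
proof (induction n arbitrary: u)
  case (Suc n)
  then obtain w where w: "(u, w) \<in> parcs G" "(w, v) \<in> parcs G ^^ n"
    by (meson relpow_Suc_E2)
  then obtain p where "awalk w p v" "length p = n"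
    using Suc.IH in_arcsD2 by blast
  with w show ?case
    by (intro exI[of _ "(u, w) # p"]) (auto simp: awalk_Cons_iff)
qed (auto simp: awalk_Nil_iff)

text \<open>Removing cycles only shortens a walk. This links relation powers, which count walks,
  with \<open>graph_dist\<close>, which ranges over paths.\<close>

lemma (in pair_wf_digraph) awalk_imp_shorter_apath:
  assumes "awalk u p v"
  shows "\<exists>q. apath u q v \<and> length q \<le> length p"
  using assms
proof (induction rule: awalk_to_apath_induct)
  case (path p)
  then show ?case by (auto simp: apath_def)
next
  case (decomp p q r s)
  then have "p = q @ r @ s"
    using awalk_cyc_decomp_has_prop[of u p v] by auto
  with decomp.IH show ?case by fastforce
qed

lemma (in pair_wf_digraph) graph_dist_le:
  assumes "(u, v) \<in> ((parcs G)\<^sup>=) ^^ n" "u \<in> pverts G"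
  shows "graph_dist G u v \<le> enat n"
proof -
  obtain m where m: "m \<le> n" "(u, v) \<in> parcs G ^^ m"
    using reflcl_relpow_imp_relpow[OF assms(1)] by blast
  then obtain p where "awalk u p v" "length p = m"
    using relpow_imp_awalk[OF m(2) assms(2)] by blast
  then obtain q where q: "apath u q v" "length q \<le> m"
    using awalk_imp_shorter_apath by blast
  then have "graph_dist G u v \<le> enat (length q)"
    unfolding graph_dist_def by (intro Inf_lower) auto
  also have "\<dots> \<le> enat n" using q(2) m(1) by simp
  finally show ?thesis .
qed

lemma (in pair_wf_digraph) graph_dist_ge:
  assumes "\<And>m. (u, v) \<in> parcs G ^^ m \<Longrightarrow> n \<le> m"
  shows "enat n \<le> graph_dist G u v"
  unfolding graph_dist_def
  using assms awalk_imp_relpow by (auto intro!: Inf_greatest dest: awalkI_apath)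

section \<open>Induced paths as sequences of vertices\<close>

text \<open>Used with \<open>{..n}\<close> for an induced path of length \<open>n\<close> and with
  \<open>UNIV\<close> for an induced ray.\<close>

definition induced_path_on :: "'a rel \<Rightarrow> nat set \<Rightarrow> (nat \<Rightarrow> 'a) \<Rightarrow> bool" where
  "induced_path_on E I a \<longleftrightarrow>
     inj_on a I \<and> (\<forall>i\<in>I. \<forall>j\<in>I. (a i, a j) \<in> E \<longleftrightarrow> \<bar>int i - int j\<bar> = 1)"

text \<open>A triangle of an incomparability graph is an antichain of three elements; this is the
  form in which the two chains enter.\<close>

definition triangle_free :: "'a rel \<Rightarrow> bool" where
  "triangle_free E \<longleftrightarrow> (\<forall>x y z. (x, y) \<in> E \<longrightarrow> (y, z) \<in> E \<longrightarrow> (x, z) \<notin> E)"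

definition induced_on :: "'a pair_pre_digraph \<Rightarrow> 'a set \<Rightarrow> 'a pair_pre_digraph" where
  "induced_on G S = \<lparr> pverts = S, parcs = {(u, v) \<in> parcs G. u \<in> S \<and> v \<in> S} \<rparr>"

lemma (in pair_bidirected_digraph) pair_bidirected_digraph_induced_on:
  "pair_bidirected_digraph (induced_on G S)"
proof -
  have "sym (parcs G)"
    using pair_sym_arcs by (simp add: symmetric_def)
  then have "sym (parcs (induced_on G S))"
    by (auto simp: induced_on_def sym_def)
  then show ?thesis
    using pair_no_loops
    by unfold_locales (auto simp: induced_on_def symmetric_def)
qed

lemma (in pair_bidirected_digraph) induced_subgraph_induced_on:
  assumes "S \<subseteq> pverts G"
  shows "induced_subgraph (with_proj (induced_on G S)) (with_proj G)"
proof -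
  interpret H: pair_bidirected_digraph "induced_on G S"
    by (rule pair_bidirected_digraph_induced_on)
  have "wf_digraph (with_proj G)" "wf_digraph (with_proj (induced_on G S))"
    by unfold_locales
  with assms show ?thesis
    by (auto simp: induced_subgraph_def subgraph_def induced_on_def)
qed

lemma (in pair_bidirected_digraph) path_graph_induced_on:
  assumes "induced_path_on (parcs G) I a" "nat_interval I"
  shows "path_graph (induced_on G (a ` I))"
proof -
  have inj: "inj_on a I" using assms(1) by (simp add: induced_path_on_def)
  let ?f = "the_inv_into I a"
  have "bij_betw ?f (a ` I) I"
    using inj by (simp add: bij_betw_the_inv_into inj_on_imp_bij_betw)
  moreover have "(u, v) \<in> parcs G \<longleftrightarrow> \<bar>int (?f u) - int (?f v)\<bar> = 1"
    if "u \<in> a ` I" "v \<in> a ` I" for u v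
    using that assms(1) inj by (auto simp: induced_path_on_def the_inv_into_f_f)
  ultimately show ?thesis
    using assms(2) pair_bidirected_digraph_induced_on
    unfolding path_graph_def by (auto simp: induced_on_def)
qed

lemma induced_path_on_subset: "induced_path_on E I a \<Longrightarrow> J \<subseteq> I \<Longrightarrow> induced_path_on E J a"
  by (auto simp: induced_path_on_def intro: inj_on_subset)

lemma finite_path_imp_induced_path_on:
  assumes "finite_path Q" "induced_subgraph (with_proj Q) (with_proj G)"
  obtains a where "induced_path_on (parcs G) {..path_length Q} a" "a ` {..path_length Q} \<subseteq> pverts G"
proof -
  obtain f I where I: "nat_interval I" and f: "bij_betw f (pverts Q) I"
    and adj: "\<And>u v. u \<in> pverts Q \<Longrightarrow> v \<in> pverts Q \<Longrightarrow>
        (u, v) \<in> parcs Q \<longleftrightarrow> \<bar>int (f u) - int (f v)\<bar> = 1"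
    using assms(1) unfolding finite_path_def path_graph_def by blast
  define m where "m = Min I"
  define n where "n = path_length Q"
  have fin: "finite I" "I \<noteq> {}"
    using assms(1) f bij_betw_finite[OF f] by (auto simp: finite_path_def bij_betw_def)
  have "{m..Max I} \<subseteq> I"
    using I fin unfolding nat_interval_def m_def by (meson Max_in Min_in)
  then have I_eq: "I = {m..Max I}" using fin by (auto simp: m_def)
  have "card I = Suc n"
    using assms(1) bij_betw_same_card[OF f] fin
    unfolding n_def path_length_def finite_path_def by (simp add: card_gt_0_iff)
  moreover have "card I = Suc (Max I) - m" using I_eq by (metis card_atLeastAtMost)
  ultimately have "Max I = m + n" by linarith
  then have I_eq': "I = {m..m + n}" using I_eq by metis
  \<comment> \<open>The labels of \<open>Q\<close> may start at any \<open>m\<close>; the shift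
    makes the sequence start at 0.\<close>
  define a where "a i = the_inv_into (pverts Q) f (m + i)" for i
  have inj: "inj_on f (pverts Q)" and im: "f ` pverts Q = I" using f by (auto simp: bij_betw_def)
  have fa: "f (a i) = m + i" and aQ: "a i \<in> pverts Q" if "i \<le> n" for i
    using that I_eq' im inj the_inv_into_into[OF inj]
    by (auto simp: a_def f_the_inv_into_f)
  have sub: "pverts Q \<subseteq> pverts G" and
    arcs: "parcs Q = {e \<in> parcs G. fst e \<in> pverts Q \<and> snd e \<in> pverts Q}"
    using assms(2) by (auto simp: induced_subgraph_def subgraph_def)
  have "(a i, a j) \<in> parcs G \<longleftrightarrow> \<bar>int i - int j\<bar> = 1" if "i \<le> n" "j \<le> n" for i j
    using adj[OF aQ[OF that(1)] aQ[OF that(2)]] that aQ fa arcs by auto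
  moreover have "inj_on a {..n}"
    by (rule inj_onI) (metis add_left_cancel atMost_iff fa)
  ultimately show ?thesis
    using that[of a] sub aQ unfolding induced_path_on_def n_def by auto
qed

lemma (in pair_bidirected_digraph) ray_imp_infinite_path:
  assumes "induced_path_on (parcs G) UNIV a" "range a \<subseteq> pverts G"
  shows "\<exists>R. infinite_path R \<and> induced_subgraph (with_proj R) (with_proj G)"
proof (intro exI conjI)
  have "infinite (range a)"
    using assms(1) by (simp add: induced_path_on_def finite_image_iff)
  then show "infinite_path (induced_on G (range a))"
    using path_graph_induced_on[OF assms(1)]
    by (simp add: infinite_path_def nat_interval_def induced_on_def)
  show "induced_subgraph (with_proj (induced_on G (range a))) (with_proj G)"
    by (rule induced_subgraph_induced_on[OF assms(2)])
qed

lemma infinite_path_imp_ray: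
  assumes "infinite_path R" "induced_subgraph (with_proj R) (with_proj G)"
  obtains a where "induced_path_on (parcs G) UNIV a" "range a \<subseteq> pverts G"
proof -
  obtain f I where I: "nat_interval I" and f: "bij_betw f (pverts R) I"
    and adj: "\<And>u v. u \<in> pverts R \<Longrightarrow> v \<in> pverts R \<Longrightarrow>
        (u, v) \<in> parcs R \<longleftrightarrow> \<bar>int (f u) - int (f v)\<bar> = 1"
    using assms(1) unfolding infinite_path_def path_graph_def by blast
  have inj: "inj_on f (pverts R)" and im: "f ` pverts R = I" using f by (auto simp: bij_betw_def)
  have inf: "infinite I" using assms(1) bij_betw_finite[OF f] by (simp add: infinite_path_def)
  \<comment> \<open>Any label can serve as the start: an infinite interval contains everything above
    it, and the vertices labelled below \<open>m\<close> are dropped.\<close>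
  then obtain m where m: "m \<in> I" by (metis finite.emptyI equals0I)
  have mI: "m + i \<in> I" for i
  proof -
    obtain k where "k \<in> I" "k \<ge> m + i" using inf by (meson infinite_nat_iff_unbounded_le)
    then have "m + i \<in> {m..k}" by simp
    then show ?thesis using I m \<open>k \<in> I\<close> unfolding nat_interval_def by blast
  qed
  define a where "a i = the_inv_into (pverts R) f (m + i)" for i
  have fa: "f (a i) = m + i" and aQ: "a i \<in> pverts R" for i
    using mI im inj the_inv_into_into[OF inj] by (auto simp: a_def f_the_inv_into_f)
  have sub: "pverts R \<subseteq> pverts G" and
    arcs: "parcs R = {e \<in> parcs G. fst e \<in> pverts R \<and> snd e \<in> pverts R}"
    using assms(2) by (auto simp: induced_subgraph_def subgraph_def)
  have "(a i, a j) \<in> parcs G \<longleftrightarrow> \<bar>int i - int j\<bar> = 1" for i j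
    using adj[OF aQ aQ, of i j] aQ fa arcs by auto
  moreover have "inj a"
    by (rule injI) (metis add_left_cancel fa)
  ultimately show ?thesis
    using that[of a] sub aQ unfolding induced_path_on_def by auto
qed

text \<open>The \<open>n\<close>-th summand consists of the \<open>n + 1\<close> consecutive vertices from position
  \<open>n\<^sup>2 + n\<close> on, which leaves at least one unused vertex before the next summand.\<close>

lemma (in pair_bidirected_digraph) ray_imp_direct_sum:
  assumes a: "induced_path_on (parcs G) UNIV a" "range a \<subseteq> pverts G"
  shows "\<exists>Q :: nat \<Rightarrow> 'a pair_pre_digraph.
        (\<forall>n. finite_path (Q n)) \<and>
        disjoint_family (\<lambda>n. pverts (Q n)) \<and>
        (\<forall>N. \<exists>n. path_length (Q n) \<ge> N) \<and>
        induced_subgraph (with_proj (direct_sum Q UNIV)) (with_proj G)"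
proof -
  define I where "I n = {n * n + n..n * n + n + n}" for n :: nat
  define Q where "Q n = induced_on G (a ` I n)" for n
  have inj: "inj a" and adj: "\<And>i j. (a i, a j) \<in> parcs G \<longleftrightarrow> \<bar>int i - int j\<bar> = 1"
    using a(1) by (auto simp: induced_path_on_def)
  have far: "i + 1 < j" if "i \<in> I m" "j \<in> I n" "m < n" for i j m n
  proof -
    have "Suc m * Suc m + Suc m \<le> n * n + n"
      using that(3) by (intro add_mono mult_mono) auto
    then show ?thesis using that by (auto simp: I_def)
  qed
  \<comment> \<open>Distance 0 yields disjointness of the summands, distance 1 the absence of edges
    between them.\<close>
  have same: "m = n" if "i \<in> I m" "j \<in> I n" "\<bar>int i - int j\<bar> \<le> 1" for i j m n
    using far[of i m j n] far[of j n i m] that by (cases m n rule: linorder_cases) auto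
  have "finite_path (Q n)" for n
    using path_graph_induced_on[OF induced_path_on_subset[OF a(1) subset_UNIV], of "I n"]
    by (auto simp: finite_path_def Q_def induced_on_def I_def nat_interval_def)
  moreover have "disjoint_family (\<lambda>n. pverts (Q n))"
    using inj same by (fastforce simp: disjoint_family_on_def Q_def induced_on_def inj_eq)
  moreover have "path_length (Q n) = n" for n
    using inj by (simp add: path_length_def Q_def induced_on_def I_def card_image inj_on_subset)
  moreover have "induced_subgraph (with_proj (direct_sum Q UNIV)) (with_proj G)"
  proof -
    have "direct_sum Q UNIV = induced_on G (\<Union>n. a ` I n)"
    proof -
      have "(u, v) \<in> (\<Union>n. parcs (Q n)) \<longleftrightarrow> (u, v) \<in> parcs (induced_on G (\<Union>n. a ` I n))"
        for u v
      proof
        assume "(u, v) \<in> parcs (induced_on G (\<Union>n. a ` I n))"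
        then obtain m n i j where ij: "i \<in> I m" "j \<in> I n" "u = a i" "v = a j"
          and uv: "(a i, a j) \<in> parcs G"
          by (auto simp: induced_on_def)
        then have "m = n" using same[of i m j n] adj by simp
        with ij uv show "(u, v) \<in> (\<Union>n. parcs (Q n))"
          by (auto simp: Q_def induced_on_def)
      qed (auto simp: Q_def induced_on_def)
      then have "(\<Union>n. parcs (Q n)) = parcs (induced_on G (\<Union>n. a ` I n))" by auto
      then show ?thesis by (simp add: direct_sum_def Q_def induced_on_def)
    qed
    then show ?thesis
      using induced_subgraph_induced_on[of "\<Union>n. a ` I n"] a(2) by auto
  qed
  ultimately show ?thesis by (intro exI[of _ Q]) auto
qed

lemma direct_sum_imp_detour:
  assumes Q: "\<And>n. finite_path (Q n)" "disjoint_family (\<lambda>n. pverts (Q n))"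
    "\<And>N. \<exists>n :: nat. path_length (Q n) \<ge> N"
    and ind: "induced_subgraph (with_proj (direct_sum Q UNIV)) (with_proj G)"
  shows "detour G = \<infinity>"
proof -
  have wf: "pair_wf_digraph (Q n)" for n
    using Q(1)[of n] unfolding finite_path_def path_graph_def
    by (simp add: pair_bidirected_digraph_def pair_sym_digraph_def)
  have ind_Q: "induced_subgraph (with_proj (Q n)) (with_proj G)" for n
  proof -
    have "parcs (Q n) = {e \<in> parcs G. fst e \<in> pverts (Q n) \<and> snd e \<in> pverts (Q n)}"
    proof (intro equalityI subsetI)
      fix e assume "e \<in> parcs (Q n)"
      moreover from this have "e \<in> parcs G"
        using ind by (auto simp: induced_subgraph_def subgraph_def direct_sum_def)
      ultimately show "e \<in> {e \<in> parcs G. fst e \<in> pverts (Q n) \<and> snd e \<in> pverts (Q n)}"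
        using wf[of n] by (simp add: pair_wf_digraph.arc_fst_in_verts pair_wf_digraph.arc_snd_in_verts)
    next
      fix e assume e: "e \<in> {e \<in> parcs G. fst e \<in> pverts (Q n) \<and> snd e \<in> pverts (Q n)}"
      then have "e \<in> parcs (direct_sum Q UNIV)"
        using ind by (auto simp: induced_subgraph_def direct_sum_def)
      \<comment> \<open>The edge belongs to some summand, and disjointness of the vertex sets forces
        that summand to be \<open>Q n\<close>.\<close>
      then obtain m where m: "e \<in> parcs (Q m)" by (auto simp: direct_sum_def)
      then have "fst e \<in> pverts (Q m)" using wf[of m] by (simp add: pair_wf_digraph.arc_fst_in_verts)
      then have "m = n" using Q(2) e by (auto simp: disjoint_family_on_def)
      with m show "e \<in> parcs (Q n)" by simp
    qed
    moreover have "wf_digraph (with_proj (Q n))"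
      using wf[of n] by (simp add: wf_digraph_def pair_wf_digraph_def)
    ultimately show ?thesis
      using ind by (auto simp: induced_subgraph_def subgraph_def direct_sum_def)
  qed
  have "enat N \<le> detour G" for N
  proof -
    obtain n where "path_length (Q n) \<ge> N" using Q(3) by blast
    moreover have "enat (path_length (Q n)) \<le> detour G"
      unfolding detour_def using Q(1) ind_Q by (intro Sup_upper) auto
    ultimately show ?thesis by (meson enat_ord_simps(1) order_trans)
  qed
  then show ?thesis by (metis enat_ord_simps(1) Suc_n_not_le_n not_infinity_eq)
qed

section \<open>Extracting an induced ray from a walk\<close>

text \<open>Injectivity comes for free: if \<open>a k = a l\<close> with \<open>k < l\<close>, then
  \<open>a k\<close> is adjacent to \<open>a (Suc l)\<close>, whence \<open>l = k\<close>.\<close>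

lemma induced_path_on_UNIV_I:
  assumes "sym E" "\<And>k l. k < l \<Longrightarrow> (a k, a l) \<in> E \<longleftrightarrow> l = Suc k" "irrefl E"
  shows "induced_path_on E UNIV a"
proof -
  have "a k \<noteq> a l" if "k < l" for k l
  proof
    assume "a k = a l"
    moreover have "(a l, a (Suc l)) \<in> E" using assms(2)[of l "Suc l"] by simp
    ultimately show False using assms(2)[of k "Suc l"] that by simp
  qed
  then have "inj a" by (metis injI linorder_neqE_nat)
  moreover have "(a k, a l) \<in> E \<longleftrightarrow> \<bar>int k - int l\<bar> = 1" for k l
    using assms(2)[of k l] assms(2)[of l k] symD[OF assms(1)] assms(3)
    by (cases k l rule: linorder_cases) (auto simp: irrefl_def)
  ultimately show ?thesis by (simp add: induced_path_on_def)
qed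

text \<open>Always jumping to the last vertex of the walk adjacent to the current one produces
  an induced path.\<close>

lemma walk_imp_ray:
  assumes E: "sym E" "irrefl E"
    and step: "\<And>i. (w i, w (Suc i)) \<in> E"
    and fin: "\<And>i. finite {j. (w i, w j) \<in> E}"
  shows "\<exists>a. induced_path_on E UNIV a \<and> range a \<subseteq> range w"
proof -
  define nxt where "nxt i = Max {j. (w i, w j) \<in> E}" for i
  have nxt_adj: "(w i, w (nxt i)) \<in> E" for i
    using Max_in[OF fin[of i]] step[of i] unfolding nxt_def by blast
  have nxt_ge: "j \<le> nxt i" if "(w i, w j) \<in> E" for i j
    using Max_ge[OF fin[of i]] that unfolding nxt_def by blast
  define p where "p k = (nxt ^^ k) 0" for k
  have p_Suc: "p (Suc k) = nxt (p k)" for k by (simp add: p_def)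
  have "p k < p (Suc k)" for k
    using nxt_ge[OF step[of "p k"]] by (simp add: p_Suc)
  then have mono: "strict_mono p" by (simp add: strict_mono_Suc_iff)
  have "(w (p k), w (p l)) \<in> E \<longleftrightarrow> l = Suc k" if "k < l" for k l
  proof
    assume "(w (p k), w (p l)) \<in> E"
    then have "p l \<le> p (Suc k)" using nxt_ge p_Suc by simp
    with mono that show "l = Suc k" by (simp add: strict_mono_less_eq)
  next
    assume "l = Suc k"
    then show "(w (p k), w (p l)) \<in> E" using nxt_adj p_Suc by simp
  qed
  then have "induced_path_on E UNIV (w \<circ> p)"
    by (intro induced_path_on_UNIV_I[OF E(1) _ E(2)]) simp
  then show ?thesis by (intro exI[of _ "w \<circ> p"]) auto
qed

text \<open>The transitive closure makes every piece nonempty, so the concatenation is infinite. The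
  index \<open>s i\<close> of the piece containing the \<open>i\<close>-th arc tends to infinity,
  which later makes the walk leave every ball.\<close>

lemma concat_walks:
  fixes y :: "nat \<Rightarrow> 'a"
  assumes "\<And>k. (y k, y (Suc k)) \<in> (R k)\<^sup>+"
  shows "\<exists>w s. \<forall>i. (w i, w (Suc i)) \<in> R (s i) \<and> (\<forall>k. \<exists>N. \<forall>i\<ge>N. k \<le> s i)"
proof -
  have "\<exists>n f. n > 0 \<and> f 0 = y k \<and> f n = y (Suc k) \<and> (\<forall>i<n. (f i, f (Suc i)) \<in> R k)" for k
    using assms[of k] by (force simp: trancl_power relpow_fun_conv)
  then obtain n f where n: "\<And>k. n k > (0::nat)" and
    f: "\<And>k. f k 0 = y k" "\<And>k. f k (n k) = y (Suc k)"
       "\<And>k i. i < n k \<Longrightarrow> (f k i, f k (Suc i)) \<in> R k"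
    by metis
  \<comment> \<open>\<open>t k\<close> is the position of \<open>y k\<close> on the concatenated
    walk; \<open>s i\<close> below is the piece that contains position \<open>i\<close>.\<close>
  define t where "t k = sum n {..<k}" for k
  have t_Suc: "t (Suc k) = t k + n k" for k by (simp add: t_def)
  have "t k < t (Suc k)" for k using n by (simp add: t_Suc)
  then have mono: "strict_mono t" by (simp add: strict_mono_Suc_iff)
  have less: "i < t (Suc i)" for i using strict_mono_imp_increasing[OF mono, of "Suc i"] by simp
  define s where "s i = (LEAST k. i < t (Suc k))" for i
  have s_less: "i < t (Suc (s i))" for i unfolding s_def using less by (rule LeastI)
  have s_le: "t (s i) \<le> i" for i
  proof (cases "s i")
    case (Suc k)
    then have "\<not> i < t (Suc k)" using not_less_Least[of k "\<lambda>k. i < t (Suc k)"] by (simp add: s_def)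
    with Suc show ?thesis by simp
  qed (simp add: t_def)
  have s_eq: "s i = k" if "t k \<le> i" "i < t (Suc k)" for i k
  proof -
    have "t k < t (Suc (s i))" "t (s i) < t (Suc k)"
      using that s_less[of i] s_le[of i] by linarith+
    then show ?thesis using mono by (simp add: strict_mono_less)
  qed
  define w where "w i = f (s i) (i - t (s i))" for i
  have "(w i, w (Suc i)) \<in> R (s i)" for i
  proof (cases "Suc i < t (Suc (s i))")
    case True
    then have "s (Suc i) = s i" using s_le[of i] by (intro s_eq) auto
    then show ?thesis
      using f(3)[of "i - t (s i)" "s i"] s_less[of i] s_le[of i]
      by (simp add: w_def t_Suc Suc_diff_le)
  next
    \<comment> \<open>Here the \<open>i\<close>-th arc is the last of its piece; its end
      \<open>y (Suc (s i))\<close> is also the first vertex of the next piece.\<close>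
    case False
    then have i: "Suc i = t (Suc (s i))" using s_less[of i] by simp
    then have "s (Suc i) = Suc (s i)" using n[of "Suc (s i)"] by (intro s_eq) (auto simp: t_Suc)
    then have "w (Suc i) = f (s i) (n (s i))" using i f by (simp add: w_def)
    also have "n (s i) = Suc (i - t (s i))" using i s_le[of i] t_Suc[of "s i"] by linarith
    finally show ?thesis using f(3)[of "i - t (s i)" "s i"] s_less[of i] s_le[of i]
      by (simp add: w_def t_Suc)
  qed
  moreover have "k \<le> s i" if "i \<ge> t k" for i k
  proof -
    have "t k < t (Suc (s i))" using that s_less[of i] by linarith
    then show ?thesis using mono by (simp add: strict_mono_less)
  qed
  ultimately show ?thesis by blast
qed

section \<open>Incomparability graphs\<close>

text \<open>Basis of all duality arguments: facts proved for the reversed order speak of the same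
  graph.\<close>

lemma incomparability_graph_converse: "incomparability_graph V (r\<inverse>) = incomparability_graph V r"
  by (auto simp: incomparability_graph_def)

locale incomparability =
  fixes V :: "'a set" and r :: "'a rel"
  assumes poset: "partial_order_on V r"
begin

abbreviation G where "G \<equiv> incomparability_graph V r"
abbreviation E where "E \<equiv> parcs G"

sublocale pair_bidirected_digraph G
  using pair_bidirected_digraph_incomparability_graph[OF poset] .

lemma pverts_G [simp]: "pverts G = V"
  by (simp add: incomparability_graph_def)

lemma adj_iff: "(u, v) \<in> E \<longleftrightarrow> u \<in> V \<and> v \<in> V \<and> (u, v) \<notin> r \<and> (v, u) \<notin> r"
  by (simp add: incomparability_graph_def)

lemma sym_E: "sym E" and irrefl_E: "irrefl E"
  using poset by (auto simp: adj_iff sym_def irrefl_def partial_order_on_def preorder_on_def refl_on_def)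

lemma r_trans: "(x, y) \<in> r \<Longrightarrow> (y, z) \<in> r \<Longrightarrow> (x, z) \<in> r"
  using poset by (auto simp: partial_order_on_def preorder_on_def elim: transE)

lemma r_antisym: "(x, y) \<in> r \<Longrightarrow> (y, x) \<in> r \<Longrightarrow> x = y"
  using poset by (auto simp: partial_order_on_def elim: antisymD)

lemma r_in_V: "(x, y) \<in> r \<Longrightarrow> x \<in> V" "(x, y) \<in> r \<Longrightarrow> y \<in> V"
  using poset by (auto simp: partial_order_on_def preorder_on_def)

lemma converse_incomparability: "incomparability V (r\<inverse>)"
  using poset by (simp add: incomparability_def)

section \<open>Balls around a vertex: their convexity, and rays that leave them\<close>

abbreviation near :: "nat \<Rightarrow> 'a rel" where
  "near n \<equiv> (E\<^sup>=) ^^ n"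

lemma near_Suc: "(x, y) \<in> near n \<Longrightarrow> (y, z) \<in> E \<Longrightarrow> (x, z) \<in> near (Suc n)"
  by auto

lemma near_mono: "(x, y) \<in> near m \<Longrightarrow> m \<le> n \<Longrightarrow> (x, y) \<in> near n"
  by (rule reflcl_relpow_mono)

text \<open>Let \<open>z\<close> precede \<open>y\<close> on the walk. If \<open>x \<le> z\<close>,
  induction applies. Otherwise \<open>z\<close> is incomparable to \<open>x\<close>, since
  \<open>z \<le> x \<le> y\<close> is excluded, and the walk can step from \<open>z\<close> to
  \<open>x\<close> instead.\<close>

lemma near_below:
  assumes "(c, y) \<in> near n" "(c, x) \<in> r" "(x, y) \<in> r"
  shows "(c, x) \<in> near n"
  using assms
proof (induction n arbitrary: y)
  case 0
  then have "x = c" by (auto intro: r_antisym)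
  then show ?case by simp
next
  case (Suc n)
  then obtain z where z: "(c, z) \<in> near n" "z = y \<or> (z, y) \<in> E" by auto
  show ?case
  proof (cases "(x, z) \<in> r")
    case True
    then have "(c, x) \<in> near n" using Suc z by blast
    then show ?thesis by (rule reflcl_relpow_mono) simp
  next
    case False
    then have zy: "(z, y) \<in> E" using z Suc.prems by auto
    then have "(z, x) \<notin> r" using Suc.prems r_trans by (auto simp: adj_iff)
    then have "(z, x) \<in> E" using False zy Suc.prems r_in_V by (auto simp: adj_iff)
    with z(1) show ?thesis by (rule near_Suc)
  qed
qed

text \<open>A walk from \<open>y\<close> to some \<open>z \<ge> y\<close> can be shortcut so that all its vertices except the
  second one are above \<open>y\<close>: right after its last vertex that is not above \<open>y\<close>, and this
  vertex is incomparable to \<open>y\<close>.\<close>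

lemma walk_outside:
  assumes y: "(c, y) \<in> r" "(c, y) \<notin> near (Suc k)"
    and z: "(y, z) \<in> E\<^sup>*" "(y, z) \<in> r"
  shows "(y, z) \<in> {(u, v) \<in> E. (c, u) \<notin> near k}\<^sup>*"
proof -
  let ?R = "{(u, v) \<in> E. (c, u) \<notin> near k}"
  have above: "(c, v) \<notin> near k" if "(y, v) \<in> r" for v
    using near_below[of c v k y] that y near_mono[of c y k "Suc k"] by auto
  have nbr: "(c, v) \<notin> near k" if "(v, y) \<in> E" for v
    using near_Suc that y(2) by blast
  from z show ?thesis
  proof (induction rule: rtrancl_induct)
    case (step u v)
    show ?case
    proof (cases "(y, u) \<in> r")
      case True
      with step above[of u] show ?thesis by (auto intro: rtrancl_into_rtrancl)
    next
      \<comment> \<open>The walk so far is discarded in favour of \<open>y\<close>,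
        \<open>u\<close>, \<open>v\<close>. Since \<open>y \<le> v\<close>, having
        \<open>u \<le> y\<close> would make \<open>u\<close> and \<open>v\<close>
        comparable.\<close>
      case False
      have "(u, y) \<notin> r" using step r_trans by (auto simp: adj_iff)
      then have yu: "(y, u) \<in> E" using False step r_in_V by (auto simp: adj_iff)
      then have "(u, y) \<in> E" using sym_E by (auto dest: symD)
      then have "(u, v) \<in> ?R" using nbr step by auto
      moreover have "(y, u) \<in> ?R"
        using yu above[of y] y r_in_V poset
        by (auto simp: partial_order_on_def preorder_on_def refl_on_def)
      ultimately show ?thesis by (meson r_into_rtrancl rtrancl_into_rtrancl)
    qed
  qed simp
qed

lemma ray_above:
  assumes conn: "\<And>x. x \<in> V \<Longrightarrow> (c, x) \<in> E\<^sup>*"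
    and unbounded: "\<And>n. \<exists>x. (c, x) \<in> r \<and> (c, x) \<notin> near n"
  shows "\<exists>a. induced_path_on E UNIV a \<and> range a \<subseteq> V"
proof -
  have ex_near: "\<exists>m. (c, x) \<in> near m" if "x \<in> V" for x
    using conn[OF that] relpow_imp_reflcl_relpow rtrancl_imp_relpow by (metis order_refl)
  have conn': "(x, y) \<in> E\<^sup>*" if "x \<in> V" "y \<in> V" for x y
    using conn that by (meson rtrancl_trans sym_E sym_rtrancl symD)
  have "\<exists>y. \<forall>k. ((c, y k) \<in> r \<and> (c, y k) \<notin> near (Suc k)) \<and>
      ((y k, y (Suc k)) \<in> r \<and> y k \<noteq> y (Suc k))"
  proof (rule dependent_nat_choice)
    show "\<exists>x. (c, x) \<in> r \<and> (c, x) \<notin> near (Suc 0)" by (rule unbounded)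
    fix x k assume x: "(c, x) \<in> r \<and> (c, x) \<notin> near (Suc k)"
    then obtain m where m: "(c, x) \<in> near m" using ex_near r_in_V by blast
    \<comment> \<open>Radius \<open>Suc m\<close> rules out that \<open>y\<close> is adjacent to
      \<open>x\<close> or, by convexity, below it, so \<open>y\<close> is above \<open>x\<close>;
      radius \<open>Suc (Suc k)\<close> carries the invariant on.\<close>
    obtain y where y: "(c, y) \<in> r" "(c, y) \<notin> near (max (Suc m) (Suc (Suc k)))"
      using unbounded by blast
    then have ym: "(c, y) \<notin> near (Suc m)" and yk: "(c, y) \<notin> near (Suc (Suc k))"
      by (meson near_mono max.cobounded1 max.cobounded2)+
    have "(x, y) \<notin> E" using near_Suc[OF m] ym by blast
    moreover have ym': "(c, y) \<notin> near m" using ym near_mono[of c y m "Suc m"] by auto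
    then have "(y, x) \<notin> r" using near_below[OF m] y(1) by blast
    ultimately have "(x, y) \<in> r" using x y(1) r_in_V by (auto simp: adj_iff)
    moreover have "x \<noteq> y" using m ym' by auto
    ultimately show "\<exists>y. ((c, y) \<in> r \<and> (c, y) \<notin> near (Suc (Suc k))) \<and> ((x, y) \<in> r \<and> x \<noteq> y)"
      using y(1) yk by blast
  qed
  then obtain y where y: "\<And>k. (c, y k) \<in> r" "\<And>k. (c, y k) \<notin> near (Suc k)"
    "\<And>k. (y k, y (Suc k)) \<in> r" "\<And>k. y k \<noteq> y (Suc k)" by blast
  define R where "R k = {(u, v) \<in> E. (c, u) \<notin> near k}" for k
  have "(y k, y (Suc k)) \<in> (R k)\<^sup>+" for k
  proof -
    have "(y k, y (Suc k)) \<in> E\<^sup>*" using y(3)[of k] by (intro conn') (auto dest: r_in_V)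
    then have "(y k, y (Suc k)) \<in> (R k)\<^sup>*"
      unfolding R_def by (intro walk_outside[OF y(1) y(2) _ y(3)])
    then show ?thesis using y(4)[of k] by (blast dest: rtranclD)
  qed
  then obtain w s where step: "\<And>i. (w i, w (Suc i)) \<in> R (s i)"
    and lim: "\<And>k. \<exists>N. \<forall>i\<ge>N. k \<le> s i"
    using concat_walks[of y R] by blast
  have wE: "(w i, w (Suc i)) \<in> E" and far: "(c, w i) \<notin> near (s i)" for i
    using step[of i] by (auto simp: R_def)
  have wV: "range w \<subseteq> V" using wE by (auto simp: adj_iff)
  \<comment> \<open>All neighbours of \<open>w i\<close> lie in the ball of radius
    \<open>Suc m\<close>, which the walk visits only finitely often.\<close>
  have "finite {j. (w i, w j) \<in> E}" for i
  proof -
    obtain m where m: "(c, w i) \<in> near m" using ex_near wV by blast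
    obtain N where N: "\<And>j. j \<ge> N \<Longrightarrow> Suc m \<le> s j" using lim by blast
    have "{j. (w i, w j) \<in> E} \<subseteq> {..<N}"
    proof
      fix j assume "j \<in> {j. (w i, w j) \<in> E}"
      then have "(c, w j) \<in> near (Suc m)" using near_Suc[OF m] by simp
      then have "\<not> Suc m \<le> s j" using far[of j] by (meson near_mono)
      then show "j \<in> {..<N}" using N by (meson lessThan_iff not_le)
    qed
    then show ?thesis by (rule finite_subset) simp
  qed
  then obtain a where "induced_path_on E UNIV a" "range a \<subseteq> range w"
    using walk_imp_ray[of E w] sym_E irrefl_E wE by blast
  with wV show ?thesis by blast
qed

text \<open>If the elements above \<open>c\<close> all lie in one ball, of radius \<open>m\<close>,
  then a vertex outside it and not adjacent to \<open>c\<close> must be below \<open>c\<close>, so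
  the dual order has far elements above \<open>c\<close>.\<close>

lemma unbounded_imp_ray:
  assumes conn: "\<And>x. x \<in> V \<Longrightarrow> (c, x) \<in> E\<^sup>*"
    and unbounded: "\<And>n. \<exists>x\<in>V. (c, x) \<notin> near n" and c: "c \<in> V"
  shows "\<exists>a. induced_path_on E UNIV a \<and> range a \<subseteq> V"
proof (cases "\<forall>n. \<exists>x. (c, x) \<in> r \<and> (c, x) \<notin> near n")
  case True
  then show ?thesis using ray_above conn by blast
next
  case False
  then obtain m where m: "\<And>x. (c, x) \<in> r \<Longrightarrow> (c, x) \<in> near m" by blast
  interpret dual: incomparability V "r\<inverse>" by (rule converse_incomparability)
  have "\<exists>x. (c, x) \<in> r\<inverse> \<and> (c, x) \<notin> near n" for n
  proof -
    obtain x where x: "x \<in> V" "(c, x) \<notin> near (Suc (max m n))" using unbounded by blast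
    then have far: "(c, x) \<notin> near k" if "k \<le> Suc (max m n)" for k
      using that near_mono[of c x] by blast
    have "(c, x) \<notin> E" using far[of "Suc 0"] by auto
    moreover have "(c, x) \<notin> r" using m far[of m] by (meson le_SucI max.cobounded1)
    ultimately have "(x, c) \<in> r" using x c by (auto simp: adj_iff)
    moreover have "(c, x) \<notin> near n" by (rule far) simp
    ultimately show ?thesis by blast
  qed
  then show ?thesis
    using dual.ray_above[of c] conn by (simp add: incomparability_graph_converse)
qed

text \<open>If a ball of radius \<open>n\<close> around \<open>c\<close> were all of
  \<open>V\<close>, going through \<open>c\<close> would bound every distance by
  \<open>2 n\<close>.\<close>

lemma infinite_diameter_imp_ray:
  assumes conn: "\<And>x y. x \<in> V \<Longrightarrow> y \<in> V \<Longrightarrow> (x, y) \<in> E\<^sup>*"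
    and diam: "diameter G = \<infinity>"
  shows "\<exists>a. induced_path_on E UNIV a \<and> range a \<subseteq> V"
proof -
  have "V \<noteq> {}" using diam by (auto simp: diameter_def bot_enat_def)
  then obtain c where c: "c \<in> V" by blast
  have "\<exists>x\<in>V. (c, x) \<notin> near n" for n
  proof (rule ccontr)
    assume "\<not> (\<exists>x\<in>V. (c, x) \<notin> near n)"
    then have all: "(c, x) \<in> near n" if "x \<in> V" for x using that by blast
    have "graph_dist G x y \<le> enat (n + n)" if "x \<in> V" "y \<in> V" for x y
    proof -
      have "sym (E\<^sup>=)" using sym_E by (auto simp: sym_def)
      then have "(x, c) \<in> near n" using all[OF that(1)] by (rule sym_relpow)
      then have "(x, y) \<in> near (n + n)" using all[OF that(2)] by (auto simp: relpow_add)
      then show ?thesis using that by (intro graph_dist_le) auto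
    qed
    then have "diameter G \<le> enat (n + n)" unfolding diameter_def by (auto intro: Sup_least)
    with diam show False by simp
  qed
  then show ?thesis using unbounded_imp_ray[of c] conn c by blast
qed

section \<open>Induced paths in posets of width two\<close>

context
  fixes a :: "nat \<Rightarrow> 'a" and n :: nat
  assumes path: "induced_path_on E {..n} a" and path_in_V: "a ` {..n} \<subseteq> V"
begin

lemma path_adj: "i \<le> n \<Longrightarrow> Suc i \<le> n \<Longrightarrow> (a i, a (Suc i)) \<in> E"
  using path by (auto simp: induced_path_on_def)

lemma path_comparable: "i + 2 \<le> j \<Longrightarrow> j \<le> n \<Longrightarrow> (a i, a j) \<in> r \<or> (a j, a i) \<in> r"
proof -
  assume ij: "i + 2 \<le> j" "j \<le> n"
  then have "i \<le> n" "\<bar>int i - int j\<bar> \<noteq> 1" by linarith+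
  then have "(a i, a j) \<notin> E" using ij path by (simp add: induced_path_on_def)
  then show ?thesis using ij path_in_V by (auto simp: adj_iff image_subset_iff)
qed

text \<open>Otherwise \<open>a (Suc j) \<le> a i \<le> a j\<close>, although consecutive vertices
  are incomparable.\<close>

lemma path_below_Suc:
  assumes "(a i, a j) \<in> r" "i + 2 \<le> j" "Suc j \<le> n"
  shows "(a i, a (Suc j)) \<in> r"
proof -
  have "(a (Suc j), a j) \<notin> r" using path_adj[of j] assms(3) by (simp add: adj_iff)
  then have "(a (Suc j), a i) \<notin> r" using assms(1) r_trans by blast
  then show ?thesis using path_comparable[of i "Suc j"] assms(2,3) by simp
qed

text \<open>Otherwise \<open>a i \<le> a (i + 3) \<le> a (Suc i)\<close>, again contradicting
  adjacency.\<close>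

lemma path_shift:
  assumes "(a i, a (i + 2)) \<in> r" "i + 3 \<le> n"
  shows "(a (Suc i), a (i + 3)) \<in> r"
proof -
  have "(a i, a (i + 3)) \<in> r"
    using path_below_Suc[of i "i + 2"] assms by (simp add: eval_nat_numeral)
  moreover have "(a i, a (Suc i)) \<notin> r" using path_adj[of i] assms(2) by (simp add: adj_iff)
  ultimately have "(a (i + 3), a (Suc i)) \<notin> r" using r_trans by blast
  then show ?thesis using path_comparable[of "Suc i" "i + 3"] assms(2) by simp
qed

text \<open>The first comparison fixes the direction of the whole path: \<open>path_shift\<close>
  moves it along, and \<open>path_below_Suc\<close> widens the gap.\<close>

lemma path_increasing:
  assumes "(a 0, a 2) \<in> r" "i + 2 \<le> j" "j \<le> n"
  shows "(a i, a j) \<in> r"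
proof -
  have "(a i, a (i + 2)) \<in> r" if "i + 2 \<le> n" for i
    using that
  proof (induction i)
    case (Suc i)
    then show ?case using path_shift[of i] by (simp add: eval_nat_numeral)
  qed (use assms(1) in \<open>simp add: numeral_2_eq_2\<close>)
  then have base: "(a i, a (i + 2)) \<in> r" using assms by simp
  from assms(2,3) show ?thesis
  proof (induction j rule: dec_induct)
    case (step j)
    then show ?case using path_below_Suc[of i j] by simp
  qed (use base in simp)
qed

text \<open>By the absence of triangles a vertex \<open>z\<close> that is not above \<open>a i\<close> for any \<open>i \<ge> k\<close> is
  below \<open>a k\<close> or \<open>a (k + 1)\<close>, hence below \<open>a i\<close> for all \<open>i \<ge> k + 3\<close>; no neighbour of \<open>z\<close> is
  above such an \<open>a i\<close>.\<close>

lemma path_slow: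
  assumes triangle_free: "triangle_free E"
    and up: "(a 0, a 2) \<in> r"
    and "(a 0, x) \<in> near m" "1 + 3 * m \<le> k" "k \<le> n"
  shows "(a k, x) \<notin> r"
  using assms(3-)
proof (induction m arbitrary: x k)
  case 0
  show ?case
  proof
    assume "(a k, x) \<in> r"
    then have k0: "(a k, a 0) \<in> r" using 0 by simp
    show False
    proof (cases "k = 1")
      case True
      then show ?thesis using k0 path_adj[of 0] 0 by (simp add: adj_iff)
    next
      case False
      then have "(a 0, a k) \<in> r" using path_increasing[OF up, of 0 k] 0 by simp
      then have "a k = a 0" using k0 r_antisym by blast
      then show ?thesis using path 0 by (auto simp: induced_path_on_def dest: inj_onD)
    qed
  qed
next
  case (Suc m)
  then obtain z where z: "(a 0, z) \<in> near m" "z = x \<or> (z, x) \<in> E" by auto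
  show ?case
  proof (cases "z = x")
    case True
    then show ?thesis using Suc.IH[OF z(1), of k] Suc.prems by simp
  next
    case False
    then have zx: "(z, x) \<in> E" using z by simp
    \<comment> \<open>The least index covered by the induction hypothesis. As
      \<open>l + 3 \<le> k\<close>, both \<open>l\<close> and \<open>Suc l\<close> are at least two
      before \<open>k\<close>, as \<open>path_increasing\<close> demands.\<close>
    define l where "l = 1 + 3 * m"
    have l: "l + 3 \<le> k" "Suc l \<le> n" using Suc.prems by (auto simp: l_def)
    have not_above: "(a l, z) \<notin> r" "(a (Suc l), z) \<notin> r"
      using Suc.IH[OF z(1), of l] Suc.IH[OF z(1), of "Suc l"] l by (auto simp: l_def)
    have "(z, a l) \<notin> E \<or> (z, a (Suc l)) \<notin> E"
      using triangle_free path_adj[of l] l sym_E unfolding triangle_free_def by (meson Suc_leD symD)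
    then have "(z, a l) \<in> r \<or> (z, a (Suc l)) \<in> r"
      using not_above zx l path_in_V by (auto simp: adj_iff image_subset_iff)
    moreover have "(a l, a k) \<in> r" "(a (Suc l), a k) \<in> r"
      using path_increasing[OF up] l Suc.prems by auto
    ultimately have "(z, a k) \<in> r" using r_trans[of z _ "a k"] by blast
    then show ?thesis using zx r_trans[of z "a k" x] by (auto simp: adj_iff)
  qed
qed

lemma path_dist_above:
  assumes "triangle_free E"
    and "(a 0, a 2) \<in> r" "(a 0, a n) \<in> near m"
  shows "n \<le> 3 * m"
proof (rule ccontr)
  assume "\<not> n \<le> 3 * m"
  then have "(a n, a n) \<notin> r" using path_slow[OF assms, of n] by simp
  then show False
    using path_in_V poset by (auto simp: partial_order_on_def preorder_on_def refl_on_def)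
qed

end

text \<open>The pair \<open>a 0\<close>, \<open>a 2\<close> decides between the order and its dual;
  the summand 1 covers paths too short to contain \<open>a 2\<close>.\<close>

lemma path_dist:
  assumes path: "induced_path_on E {..n} a" "a ` {..n} \<subseteq> V"
    and triangle_free: "triangle_free E"
    and m: "(a 0, a n) \<in> E ^^ m"
  shows "n \<le> 3 * m + 1"
proof (cases "n \<ge> 2")
  case True
  interpret dual: incomparability V "r\<inverse>" by (rule converse_incomparability)
  have "(a 0, a n) \<in> near m" using m by (rule relpow_imp_reflcl_relpow) simp
  moreover have "(a 0, a 2) \<in> r \<or> (a 0, a 2) \<in> r\<inverse>"
    using path_comparable[OF path, of 0 2] True by simp
  ultimately show ?thesis
    using path_dist_above[OF path triangle_free, of m]
      dual.path_dist_above[of n a m, unfolded incomparability_graph_converse, OF path triangle_free]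
    by auto
qed simp

lemma infinite_detour_imp_infinite_diameter:
  assumes triangle_free: "triangle_free E"
    and detour: "detour G = \<infinity>"
  shows "diameter G = \<infinity>"
proof -
  have "enat N \<le> diameter G" for N
  proof -
    have "enat (3 * N + 1) < detour G" using detour by simp
    then obtain Q where Q: "finite_path Q" "induced_subgraph (with_proj Q) (with_proj G)"
      and len: "3 * N + 1 < path_length Q"
      unfolding detour_def less_Sup_iff by auto
    define n where "n = path_length Q"
    obtain a where a: "induced_path_on E {..n} a" "a ` {..n} \<subseteq> V"
      using finite_path_imp_induced_path_on[OF Q] unfolding n_def by auto
    have "enat N \<le> graph_dist G (a 0) (a n)"
    proof (rule graph_dist_ge)
      fix m assume "(a 0, a n) \<in> E ^^ m"
      then have "n \<le> 3 * m + 1" by (rule path_dist[OF a triangle_free])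
      with len show "N \<le> m" by (simp add: n_def)
    qed
    also have "\<dots> \<le> diameter G"
      unfolding diameter_def using a(2) by (intro Sup_upper) auto
    finally show ?thesis .
  qed
  then show ?thesis by (metis enat_ord_simps(1) Suc_n_not_le_n not_infinity_eq)
qed

end

section \<open>Unions of two chains and the equivalence\<close>

lemma union_of_two_chains_triangle_free:
  assumes "C \<in> Chains r" "D \<in> Chains r" "V = C \<union> D"
  shows "triangle_free (parcs (incomparability_graph V r))"
  \<comment> \<open>Two of any three vertices lie in a common chain and are thus comparable.\<close>
  using assms unfolding triangle_free_def incomparability_graph_def Chains_def by simp blast

text \<open>\<open>connected\<close> means strong connectedness of the symmetric closure, which adds
  no reachability to a symmetric graph.\<close>

lemma (in pair_bidirected_digraph) connected_imp_rtrancl: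
  assumes "connected (with_proj G)" "x \<in> pverts G" "y \<in> pverts G"
  shows "(x, y) \<in> (parcs G)\<^sup>*"
proof -
  have "x \<rightarrow>\<^sup>*\<^bsub>with_proj (mk_symmetric (with_proj G))\<^esub> y"
    using assms by (auto simp: connected_def strongly_connected_def)
  then have "x \<rightarrow>\<^sup>*\<^bsub>with_proj G\<^esub> y"
    using reachable_mk_symmetric_eq pair_sym_arcs by blast
  then show ?thesis
    unfolding reachable_def by (auto dest: rtrancl_on_rtranclI)
qed

theorem theorem2:
  fixes V :: "'a set" and r :: "'a rel"
  defines "G \<equiv> incomparability_graph V r"
  assumes poset: "partial_order_on V r"
    and two_chains: "\<exists>C \<in> Chains r. \<exists>D \<in> Chains r. V = C \<union> D"
    and conn: "connected (with_proj G)"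
  defines "i \<equiv> \<exists>Q :: nat \<Rightarrow> 'a pair_pre_digraph.
        (\<forall>n. finite_path (Q n)) \<and>
        disjoint_family (\<lambda>n. pverts (Q n)) \<and>
        (\<forall>N. \<exists>n. path_length (Q n) \<ge> N) \<and>
        induced_subgraph (with_proj (direct_sum Q UNIV)) (with_proj G)"
    and "ii \<equiv> detour G = \<infinity>"
    and "iii \<equiv> diameter G = \<infinity>"
    and "iv \<equiv> \<exists>R. infinite_path R \<and> induced_subgraph (with_proj R) (with_proj G)"
  shows "(i \<longleftrightarrow> ii) \<and> (ii \<longleftrightarrow> iii) \<and> (iii \<longleftrightarrow> iv)"
proof -
  interpret P: incomparability V r using poset by unfold_locales
  have G: "G = incomparability_graph V r" by (simp add: G_def)
  have triangle_free: "triangle_free (parcs G)"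
    using two_chains union_of_two_chains_triangle_free unfolding G by metis
  \<comment> \<open>The implications form a cycle. The two chains serve the step from
    \<open>ii\<close> to \<open>iii\<close>, connectedness the step from \<open>iii\<close> to
    \<open>iv\<close>.\<close>
  have "i \<Longrightarrow> ii"
    unfolding i_def ii_def using direct_sum_imp_detour by blast
  moreover have "ii \<Longrightarrow> iii"
    using P.infinite_detour_imp_infinite_diameter triangle_free unfolding ii_def iii_def G by blast
  moreover have "iii \<Longrightarrow> iv"
    using P.infinite_diameter_imp_ray P.connected_imp_rtrancl P.ray_imp_infinite_path conn
    unfolding iii_def iv_def G P.pverts_G by blast
  moreover have "iv \<Longrightarrow> i"
  proof -
    assume iv
    then obtain R where "infinite_path R" "induced_subgraph (with_proj R) (with_proj G)"
      unfolding iv_def by blast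
    then obtain a where "induced_path_on (parcs G) UNIV a" "range a \<subseteq> pverts G"
      by (rule infinite_path_imp_ray)
    then show i
      unfolding i_def G by (rule P.ray_imp_direct_sum)
  qed
  ultimately show ?thesis by blast
qed

end
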